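(* Let $(\Omega,\Sigma,\mu)$ be a complete finite measure space, let $X(\mu),Y(\mu)$ be Banach function spaces, and let $\Phi:\Omega\to Lip_0(\mathbb R)$ be a strongly measurable function such that $\Phi\in\mathcal M(X,Y)(\mu,Lip_0(\mathbb R))$. Consider the operator $T_\Phi:X(\mu)\to L^0(\mu)$ given by the pointwise composition $T_\Phi(f)(w)=\Phi(w)(f(w))$. Then $T_\Phi$ is (i) a well-defined operator $T_\Phi:X(\mu)\to Y(\mu)$; (ii) Lipschitz continuous from $X(\mu)$ to $Y(\mu)$; (iii) lattice Lipschitz, and the best bound function in the lattice Lipschitz inequality is $K(\cdot)=Lip(\Phi(\cdot))$; that is, this $K$ is a bound function for $T_\Phi$, and if $h$ is any other measurable function such that the lattice Lipschitz inequality holds with bound function $h$, then $Lip(\Phi(\cdot))\le h(\cdot)$ $\mu$-a.e. Moreover, if $\Psi:\Omega\to Lip_0(\mathbb R)$ is another function such that $\Phi=\Psi$ $\mu$-a.e., then $T_\Phi=T_\Psi$ and the bound functions $w\mapsto Lip(\Phi(w))$ and $w\mapsto Lip(\Psi(w))$ are equal $\mu$-a.e.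
   Context: All functions are real-valued; $L^0(\mu)$ is the space of $\mu$-a.e. classes of measurable real functions on $\Omega$. A Banach function space $X(\mu)$ is a linear subspace of $L^0(\mu)$ which is an ideal for the $\mu$-a.e. order (if $|f|\le|g|$ a.e., $f\in L^0(\mu)$, $g\in X(\mu)$, then $f\in X(\mu)$), is a Banach space, satisfies $\|f\|\le\|g\|$ whenever $f,g\in X(\mu)$, $|f|\le|g|$ a.e., and contains $\chi_\Omega$. $\mathcal M(X,Y)=\mathcal M(X(\mu),Y(\mu))$ is the space of (classes of) measurable functions $h$ such that $hf\in Y(\mu)$ for all $f\in X(\mu)$, with the norm of the multiplication operator $M_h:X(\mu)\to Y(\mu)$, $M_h(f)=hf$. $Lip_0(\mathbb R)$ is the Banach space of Lipschitz functions $\varphi:\mathbb R\to\mathbb R$ with $\varphi(0)=0$, normed by the Lipschitz constant $Lip(\varphi)$. A function $\Psi:\Omega\to Lip_0(\mathbb R)$ is strongly measurable if it is the $\mu$-a.e. norm limit of a sequence of simple functions $\sum_{i=1}^n\varphi_i\chi_{A_i}$ ($\varphi_i\in Lip_0(\mathbb R)$, $A_i\in\Sigma$ disjoint). $\mathcal M(X,Y)(\mu,Lip_0(\mathbb R))$ is the space of strongly measurable $\Psi:\Omega\to Lip_0(\mathbb R)$ such that $w\mapsto Lip(\Psi(w))$ belongs to $\mathcal M(X,Y)$, with norm $\|Lip(\Psi(\cdot))\|_{\mathcal M(X,Y)}$. An operator $T:X(\mu)\to L^0(\mu)$ is lattice Lipschitz with bound function $K:\Omega\to[0,\infty)$ if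 for every $f,g\in X(\mu)$, $|T(f)(w)-T(g)(w)|\le K(w)|f(w)-g(w)|$ for $\mu$-a.e. $w\in\Omega$ (the null set may depend on $f,g$). *)

theory Defs
  imports "HOL-Analysis.Analysis"
begin

section \<open>Banach function spaces\<close>

text \<open>
  Classes in \<open>L\<^sup>0(\<mu>)\<close> are handled through their representatives, the elements of
  \<^term>\<open>borel_measurable M\<close>; equality in \<open>L\<^sup>0(\<mu>)\<close> is equality almost everywhere. A Banach
  function space is a set \<open>X\<close> of representatives with a norm \<open>nX\<close> on it. The axioms \<open>ideal\<close>
  and \<open>norm_mono\<close> make \<open>X\<close> closed under almost everywhere equality and \<open>nX\<close> a function of
  the class.
\<close>

locale banach_function_space =
  fixes M :: "'a measure" and X :: "('a \<Rightarrow> real) set" and nX :: "('a \<Rightarrow> real) \<Rightarrow> real"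
  assumes measurable: "X \<subseteq> borel_measurable M"
    and zero: "(\<lambda>w. 0) \<in> X"
    and add: "\<And>f g. f \<in> X \<Longrightarrow> g \<in> X \<Longrightarrow> (\<lambda>w. f w + g w) \<in> X"
    and scale: "\<And>c f. f \<in> X \<Longrightarrow> (\<lambda>w. c * f w) \<in> X"
    and ideal: "\<And>f g. f \<in> borel_measurable M \<Longrightarrow> g \<in> X \<Longrightarrow> (AE w in M. \<bar>f w\<bar> \<le> \<bar>g w\<bar>) \<Longrightarrow> f \<in> X"
    and indicator_space: "indicator (space M) \<in> X"
    and norm_nonneg: "\<And>f. f \<in> X \<Longrightarrow> 0 \<le> nX f"
    and norm_eq_0: "\<And>f. f \<in> X \<Longrightarrow> nX f = 0 \<longleftrightarrow> (AE w in M. f w = 0)"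
    and norm_scale: "\<And>c f. f \<in> X \<Longrightarrow> nX (\<lambda>w. c * f w) = \<bar>c\<bar> * nX f"
    and norm_triangle: "\<And>f g. f \<in> X \<Longrightarrow> g \<in> X \<Longrightarrow> nX (\<lambda>w. f w + g w) \<le> nX f + nX g"
    and norm_mono: "\<And>f g. f \<in> X \<Longrightarrow> g \<in> X \<Longrightarrow> (AE w in M. \<bar>f w\<bar> \<le> \<bar>g w\<bar>) \<Longrightarrow> nX f \<le> nX g"
    and complete: "\<And>s :: nat \<Rightarrow> 'a \<Rightarrow> real.
      (\<And>n. s n \<in> X) \<Longrightarrow>
      (\<forall>e>0. \<exists>N. \<forall>m\<ge>N. \<forall>n\<ge>N. nX (\<lambda>w. s m w - s n w) < e) \<Longrightarrow>
      \<exists>f\<in>X. (\<lambda>n. nX (\<lambda>w. s n w - f w)) \<longlonglongrightarrow> 0"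

definition multipliers ::
    "'a measure \<Rightarrow> ('a \<Rightarrow> real) set \<Rightarrow> ('a \<Rightarrow> real) set \<Rightarrow> ('a \<Rightarrow> real) set" where
  "multipliers M X Y = {h \<in> borel_measurable M. \<forall>f\<in>X. (\<lambda>w. h w * f w) \<in> Y}"


section \<open>Lipschitz functions vanishing at the origin\<close>

definition Lip :: "(real \<Rightarrow> real) \<Rightarrow> real" where
  "Lip \<phi> = Inf {L. L-lipschitz_on UNIV \<phi>}"

lemma Lip_lipschitz_on:
  assumes "L-lipschitz_on UNIV \<phi>"
  shows "(Lip \<phi>)-lipschitz_on UNIV \<phi>"
proof (rule lipschitz_onI)
  let ?S = "{L. L-lipschitz_on UNIV \<phi>}"
  have ne: "?S \<noteq> {}" using assms by blast
  show "0 \<le> Lip \<phi>"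
    unfolding Lip_def using ne by (intro cInf_greatest) (auto dest: lipschitz_on_nonneg)
  fix x y :: real
  show "dist (\<phi> x) (\<phi> y) \<le> Lip \<phi> * dist x y"
  proof (cases "x = y")
    case False
    then have "dist (\<phi> x) (\<phi> y) / dist x y \<le> L" if "L \<in> ?S" for L
      using lipschitz_onD[of L UNIV \<phi> x y] that by (simp add: divide_simps)
    then have "dist (\<phi> x) (\<phi> y) / dist x y \<le> Lip \<phi>"
      unfolding Lip_def using ne by (intro cInf_greatest) auto
    then show ?thesis using False by (simp add: divide_simps)
  qed simp
qed

lemma Lip_le:
  assumes "L-lipschitz_on UNIV \<phi>"
  shows "Lip \<phi> \<le> L"
  unfolding Lip_def using assms
  by (intro cInf_lower bdd_belowI[of _ 0]) (auto dest: lipschitz_on_nonneg)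

lemma Lip_nonneg: "L-lipschitz_on UNIV \<phi> \<Longrightarrow> 0 \<le> Lip \<phi>"
  by (rule lipschitz_on_nonneg[OF Lip_lipschitz_on])

lemma lipschitz_on_zero: "0-lipschitz_on UNIV (\<lambda>x::real. 0::real)"
  by (rule lipschitz_onI) auto

typedef lip0 = "{\<phi> :: real \<Rightarrow> real. \<phi> 0 = 0 \<and> (\<exists>L. L-lipschitz_on UNIV \<phi>)}"
  morphisms lip0_fun Abs_lip0
proof
  show "(\<lambda>x. 0) \<in> {\<phi> :: real \<Rightarrow> real. \<phi> 0 = 0 \<and> (\<exists>L. L-lipschitz_on UNIV \<phi>)}"
    by (rule CollectI, rule conjI[OF refl], rule exI[of _ 0], rule lipschitz_on_zero)
qed

lemma lip0_fun_0 [simp]: "lip0_fun \<phi> 0 = 0"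
  using lip0_fun[of \<phi>] by simp

lemma lip0_fun_lipschitz: "(Lip (lip0_fun \<phi>))-lipschitz_on UNIV (lip0_fun \<phi>)"
proof -
  obtain L where "L-lipschitz_on UNIV (lip0_fun \<phi>)"
    using lip0_fun[of \<phi>] by auto
  then show ?thesis by (rule Lip_lipschitz_on)
qed

lemma lip0_fun_le: "\<bar>lip0_fun \<phi> x - lip0_fun \<phi> y\<bar> \<le> Lip (lip0_fun \<phi>) * \<bar>x - y\<bar>"
  using lipschitz_onD[OF lip0_fun_lipschitz, of x y \<phi>] by (simp add: dist_real_def)

lemma lip0_eqI: "(\<And>x. lip0_fun \<phi> x = lip0_fun \<psi> x) \<Longrightarrow> \<phi> = \<psi>"
  by (simp add: lip0_fun_inject[symmetric] fun_eq_iff)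

lemma lip0_fun_Abs: "\<phi> 0 = 0 \<Longrightarrow> L-lipschitz_on UNIV \<phi> \<Longrightarrow> lip0_fun (Abs_lip0 \<phi>) = \<phi>"
  by (intro Abs_lip0_inverse) auto

instantiation lip0 :: real_normed_vector
begin

definition "0 = Abs_lip0 (\<lambda>x. 0)"
definition "\<phi> + \<psi> = Abs_lip0 (\<lambda>x. lip0_fun \<phi> x + lip0_fun \<psi> x)"
definition "\<phi> - \<psi> = Abs_lip0 (\<lambda>x. lip0_fun \<phi> x - lip0_fun \<psi> x)"
definition "- \<phi> = Abs_lip0 (\<lambda>x. - lip0_fun \<phi> x)"
definition "c *\<^sub>R \<phi> = Abs_lip0 (\<lambda>x. c * lip0_fun \<phi> x)"
definition "norm \<phi> = Lip (lip0_fun \<phi>)"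
definition "sgn (\<phi> :: lip0) = inverse (norm \<phi>) *\<^sub>R \<phi>"
definition "dist (\<phi> :: lip0) \<psi> = norm (\<phi> - \<psi>)"
definition "(uniformity :: (lip0 \<times> lip0) filter) =
  (INF e\<in>{0 <..}. principal {(\<phi>, \<psi>). dist \<phi> \<psi> < e})"
definition "open (U :: lip0 set) \<longleftrightarrow>
  (\<forall>\<phi>\<in>U. \<forall>\<^sub>F (\<phi>', \<psi>) in uniformity. \<phi>' = \<phi> \<longrightarrow> \<psi> \<in> U)"

lemma lip0_fun_zero: "lip0_fun 0 = (\<lambda>x. 0)"
  unfolding zero_lip0_def by (rule lip0_fun_Abs[OF refl lipschitz_on_zero])

lemma lip0_fun_add: "lip0_fun (\<phi> + \<psi>) = (\<lambda>x. lip0_fun \<phi> x + lip0_fun \<psi> x)"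
  unfolding plus_lip0_def
  by (rule lip0_fun_Abs[OF _ lipschitz_on_add[OF lip0_fun_lipschitz lip0_fun_lipschitz]]) simp

lemma lip0_fun_diff: "lip0_fun (\<phi> - \<psi>) = (\<lambda>x. lip0_fun \<phi> x - lip0_fun \<psi> x)"
  unfolding minus_lip0_def
  by (rule lip0_fun_Abs[OF _ lipschitz_on_diff[OF lip0_fun_lipschitz lip0_fun_lipschitz]]) simp

lemma lip0_fun_uminus: "lip0_fun (- \<phi>) = (\<lambda>x. - lip0_fun \<phi> x)"
  unfolding uminus_lip0_def
  by (rule lip0_fun_Abs[OF _ lipschitz_on_minus[OF lip0_fun_lipschitz]]) simp

lemma lip0_fun_scaleR: "lip0_fun (c *\<^sub>R \<phi>) = (\<lambda>x. c * lip0_fun \<phi> x)"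
  unfolding scaleR_lip0_def
  by (rule lip0_fun_Abs[OF _ lipschitz_on_cmult_real[OF lip0_fun_lipschitz]]) simp

lemma Lip_scale_le:
  assumes "L-lipschitz_on UNIV \<phi>"
  shows "Lip (\<lambda>x. c * \<phi> x) \<le> \<bar>c\<bar> * Lip \<phi>"
  by (rule Lip_le[OF lipschitz_on_cmult_real[OF Lip_lipschitz_on[OF assms]]])

instance
proof
  fix \<phi> \<psi> \<theta> :: lip0 and a b :: real
  note funs = lip0_fun_zero lip0_fun_add lip0_fun_diff lip0_fun_uminus lip0_fun_scaleR
  show "\<phi> + \<psi> + \<theta> = \<phi> + (\<psi> + \<theta>)" "\<phi> + \<psi> = \<psi> + \<phi>" "0 + \<phi> = \<phi>" "- \<phi> + \<phi> = 0"
    "\<phi> - \<psi> = \<phi> + - \<psi>" "a *\<^sub>R (\<phi> + \<psi>) = a *\<^sub>R \<phi> + a *\<^sub>R \<psi>" "(a + b) *\<^sub>R \<phi> = a *\<^sub>R \<phi> + b *\<^sub>R \<phi>"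
    "a *\<^sub>R b *\<^sub>R \<phi> = (a * b) *\<^sub>R \<phi>" "1 *\<^sub>R \<phi> = \<phi>"
    by (rule lip0_eqI; simp add: funs algebra_simps)+
  show "dist \<phi> \<psi> = norm (\<phi> - \<psi>)" "sgn \<phi> = inverse (norm \<phi>) *\<^sub>R \<phi>"
    by (simp_all add: dist_lip0_def sgn_lip0_def)
  show "(uniformity :: (lip0 \<times> lip0) filter) =
      (INF e\<in>{0 <..}. principal {(\<phi>, \<psi>). dist \<phi> \<psi> < e})"
    by (rule uniformity_lip0_def)
  show "open U \<longleftrightarrow> (\<forall>\<phi>\<in>U. \<forall>\<^sub>F (\<phi>', \<psi>) in uniformity. \<phi>' = \<phi> \<longrightarrow> \<psi> \<in> U)" for U :: "lip0 set"
    by (rule open_lip0_def)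
  show "norm \<phi> = 0 \<longleftrightarrow> \<phi> = 0"
  proof
    assume "norm \<phi> = 0"
    then show "\<phi> = 0"
      using lip0_fun_le[of \<phi> _ 0] by (intro lip0_eqI) (simp add: norm_lip0_def funs)
  next
    assume "\<phi> = 0"
    then show "norm \<phi> = 0"
      using Lip_le[OF lipschitz_on_zero] Lip_nonneg[OF lipschitz_on_zero] by (simp add: norm_lip0_def funs)
  qed
  show "norm (\<phi> + \<psi>) \<le> norm \<phi> + norm \<psi>"
    unfolding norm_lip0_def funs by (rule Lip_le[OF lipschitz_on_add[OF lip0_fun_lipschitz lip0_fun_lipschitz]])
  have le: "norm (c *\<^sub>R \<theta>) \<le> \<bar>c\<bar> * norm \<theta>" for c and \<theta> :: lip0
    unfolding norm_lip0_def funs by (rule Lip_scale_le[OF lip0_fun_lipschitz])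
  show "norm (a *\<^sub>R \<phi>) = \<bar>a\<bar> * norm \<phi>"
  proof (cases "a = 0")
    case True
    then show ?thesis
      using le[of 0 \<phi>] Lip_nonneg[OF lip0_fun_lipschitz[of "0 *\<^sub>R \<phi>"]] by (simp add: norm_lip0_def)
  next
    case False
    have "inverse a *\<^sub>R a *\<^sub>R \<phi> = \<phi>"
      using False by (intro lip0_eqI) (simp add: funs)
    then have "norm \<phi> \<le> \<bar>inverse a\<bar> * norm (a *\<^sub>R \<phi>)"
      using le[of "inverse a" "a *\<^sub>R \<phi>"] by simp
    then have "\<bar>a\<bar> * norm \<phi> \<le> norm (a *\<^sub>R \<phi>)"
      using False by (simp add: divide_simps mult.commute)
    then show ?thesis using le[of a \<phi>] by simp
  qed
qed

end

instance lip0 :: banach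
proof
  fix s :: "nat \<Rightarrow> lip0"
  assume s: "Cauchy s"
  have close: "\<exists>N. \<forall>m\<ge>N. \<forall>n\<ge>N. Lip (lip0_fun (s m - s n)) < e" if "0 < e" for e
    using s that unfolding Cauchy_def dist_lip0_def norm_lip0_def by blast
  have "Cauchy (\<lambda>n. lip0_fun (s n) x)" for x
  proof (rule CauchyI)
    fix e :: real assume "0 < e"
    then obtain N where N: "\<forall>m\<ge>N. \<forall>n\<ge>N. Lip (lip0_fun (s m - s n)) < e / (\<bar>x\<bar> + 1)"
      using close[of "e / (\<bar>x\<bar> + 1)"] by auto
    have "norm (lip0_fun (s m) x - lip0_fun (s n) x) < e" if "N \<le> m" "N \<le> n" for m n
    proof -
      have "\<bar>lip0_fun (s m) x - lip0_fun (s n) x\<bar> \<le> Lip (lip0_fun (s m - s n)) * \<bar>x\<bar>"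
        using lip0_fun_le[of "s m - s n" x 0] by (simp add: lip0_fun_diff)
      also have "\<dots> \<le> e / (\<bar>x\<bar> + 1) * \<bar>x\<bar>"
        using N that by (intro mult_right_mono) (auto intro: less_imp_le)
      also have "\<dots> < e" using \<open>0 < e\<close> by (simp add: field_simps)
      finally show ?thesis by simp
    qed
    then show "\<exists>N. \<forall>m\<ge>N. \<forall>n\<ge>N. norm (lip0_fun (s m) x - lip0_fun (s n) x) < e" by blast
  qed
  then have "\<forall>x. \<exists>l. (\<lambda>n. lip0_fun (s n) x) \<longlonglongrightarrow> l"
    using Cauchy_convergent convergent_def by blast
  then obtain l where l: "\<And>x. (\<lambda>n. lip0_fun (s n) x) \<longlonglongrightarrow> l x" by metis
  have diff: "e-lipschitz_on UNIV (\<lambda>x. lip0_fun (s n) x - l x)"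
    if e: "0 < e" and N: "\<forall>m\<ge>N. \<forall>n\<ge>N. Lip (lip0_fun (s m - s n)) < e" and n: "N \<le> n" for e N n
  proof (rule lipschitz_onI)
    fix x y
    have "dist (lip0_fun (s n) x - lip0_fun (s m) x) (lip0_fun (s n) y - lip0_fun (s m) y)
        \<le> e * dist x y" if "N \<le> m" for m
    proof -
      have "Lip (lip0_fun (s n - s m)) * \<bar>x - y\<bar> \<le> e * \<bar>x - y\<bar>"
        using N n that by (intro mult_right_mono) (auto intro: less_imp_le)
      then show ?thesis
        using lip0_fun_le[of "s n - s m" x y] by (simp add: lip0_fun_diff dist_real_def)
    qed
    moreover have "(\<lambda>m. dist (lip0_fun (s n) x - lip0_fun (s m) x) (lip0_fun (s n) y - lip0_fun (s m) y))
        \<longlonglongrightarrow> dist (lip0_fun (s n) x - l x) (lip0_fun (s n) y - l y)"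
      by (intro tendsto_intros l)
    ultimately show "dist (lip0_fun (s n) x - l x) (lip0_fun (s n) y - l y) \<le> e * dist x y"
      by (intro LIMSEQ_le_const2) auto
  qed (use e in simp)
  obtain N where "\<forall>m\<ge>N. \<forall>n\<ge>N. Lip (lip0_fun (s m - s n)) < 1"
    using close[of 1] by auto
  then have "1-lipschitz_on UNIV (\<lambda>x. lip0_fun (s N) x - l x)"
    using diff[of 1 N N] by simp
  from lipschitz_on_diff[OF lip0_fun_lipschitz[of "s N"] this]
  have lip_l: "(Lip (lip0_fun (s N)) + 1)-lipschitz_on UNIV l" by simp
  have "l 0 = 0" using l[of 0] by (simp add: LIMSEQ_const_iff)
  then have l_fun: "lip0_fun (Abs_lip0 l) = l" using lip_l by (rule lip0_fun_Abs)
  have "s \<longlonglongrightarrow> Abs_lip0 l"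
  proof (rule metric_LIMSEQ_I)
    fix e :: real assume "0 < e"
    then obtain N where N: "\<forall>m\<ge>N. \<forall>n\<ge>N. Lip (lip0_fun (s m - s n)) < e / 2"
      using close[of "e / 2"] by auto
    have "dist (s n) (Abs_lip0 l) < e" if "N \<le> n" for n
      using Lip_le[OF diff[OF _ N that]] \<open>0 < e\<close>
      by (simp add: dist_lip0_def norm_lip0_def lip0_fun_diff l_fun)
    then show "\<exists>N. \<forall>n\<ge>N. dist (s n) (Abs_lip0 l) < e" by blast
  qed
  then show "convergent s" by (rule convergentI)
qed

definition strongly_measurable :: "'a measure \<Rightarrow> ('a \<Rightarrow> lip0) \<Rightarrow> bool" where
  "strongly_measurable M \<Psi> \<longleftrightarrow>
    (\<exists>s. (\<forall>n::nat. simple_function M (s n)) \<and> (AE w in M. (\<lambda>n. s n w) \<longlonglongrightarrow> \<Psi> w))"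

text \<open>The space \<open>\<M>(X,Y)(\<mu>, Lip\<^sub>0(\<real>))\<close>.\<close>

definition lip0_multipliers ::
    "'a measure \<Rightarrow> ('a \<Rightarrow> real) set \<Rightarrow> ('a \<Rightarrow> real) set \<Rightarrow> ('a \<Rightarrow> lip0) set" where
  "lip0_multipliers M X Y =
    {\<Psi>. strongly_measurable M \<Psi> \<and> (\<lambda>w. Lip (lip0_fun (\<Psi> w))) \<in> multipliers M X Y}"


section \<open>Lattice Lipschitz operators\<close>

definition lattice_lipschitz_ineq ::
    "'a measure \<Rightarrow> ('a \<Rightarrow> real) set \<Rightarrow> (('a \<Rightarrow> real) \<Rightarrow> 'a \<Rightarrow> real) \<Rightarrow> ('a \<Rightarrow> real) \<Rightarrow> bool" where
  "lattice_lipschitz_ineq M X T K \<longleftrightarrow>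
    (\<forall>f\<in>X. \<forall>g\<in>X. AE w in M. \<bar>T f w - T g w\<bar> \<le> K w * \<bar>f w - g w\<bar>)"

definition lattice_lipschitz ::
    "'a measure \<Rightarrow> ('a \<Rightarrow> real) set \<Rightarrow> (('a \<Rightarrow> real) \<Rightarrow> 'a \<Rightarrow> real) \<Rightarrow> ('a \<Rightarrow> real) \<Rightarrow> bool" where
  "lattice_lipschitz M X T K \<longleftrightarrow>
    T ` X \<subseteq> borel_measurable M \<and> (\<forall>w\<in>space M. 0 \<le> K w) \<and> lattice_lipschitz_ineq M X T K"

definition composition_op :: "('a \<Rightarrow> lip0) \<Rightarrow> ('a \<Rightarrow> real) \<Rightarrow> 'a \<Rightarrow> real" where
  "composition_op \<Phi> f w = lip0_fun (\<Phi> w) (f w)"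

end

theory Submission
  imports Defs
begin

text \<open>
  Let \<open>K = Lip \<circ> \<Phi>\<close>. Pointwise, \<open>\<bar>T\<^sub>\<Phi> f - T\<^sub>\<Phi> g\<bar> \<le> K \<bar>f - g\<bar>\<close>, so everything but
  optimality of \<open>K\<close> reduces to boundedness of multiplication by \<open>K\<close>. If it were unbounded, there
  would be \<open>f\<^sub>n\<close> in the unit ball with \<open>\<parallel>K f\<^sub>n\<parallel> > n 2\<^sup>n\<close>; then \<open>F = \<Sum>\<^sub>n 2\<^sup>-\<^sup>n \<bar>f\<^sub>n\<bar>\<close> lies in \<open>X\<close>
  and dominates each summand, whence \<open>\<parallel>K F\<parallel> \<ge> n\<close> for every \<open>n\<close>. For optimality, test the
  inequality on the countably many pairs of rational constants: outside one null set,
  \<open>\<Phi>(w)\<close> is \<open>h(w)\<close>-Lipschitz on \<open>\<rat>\<close>, hence on \<open>\<real>\<close>.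
\<close>

section \<open>Measurability of the pointwise composition\<close>

text \<open>Preimages of a set under \<open>f\<close> and \<open>g\<close> differ only inside a null
  set, and completeness makes every subset of a null set measurable.\<close>

lemma (in complete_measure) measurable_cong_AE_complete:
  assumes f: "f \<in> measurable M N" and eq: "AE w in M. f w = g w"
    and g: "g \<in> space M \<rightarrow> space N"
  shows "g \<in> measurable M N"
proof (rule measurableI)
  fix A assume A: "A \<in> sets N"
  have "f -` A \<inter> space M \<in> sets M" using f A by (rule measurable_sets)
  then show "g -` A \<inter> space M \<in> sets M"
    by (rule in_sets_AE[rotated]) (use eq in auto)
qed (use g in auto)

text \<open>Evaluation at \<open>x\<close> is a bounded linear functional with bound
  \<open>\<bar>x\<bar>\<close>, because elements of \<open>lip0\<close> vanish at 0.\<close>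

lemma lip0_tendsto_apply:
  assumes "s \<longlonglongrightarrow> \<phi>"
  shows "(\<lambda>n. lip0_fun (s n) x) \<longlonglongrightarrow> lip0_fun \<phi> x"
proof -
  have "bounded_linear (\<lambda>\<phi>. lip0_fun \<phi> x)"
    using lip0_fun_le[of _ x 0]
    by (intro bounded_linear_intro[where K = "\<bar>x\<bar>"])
       (auto simp: lip0_fun_add lip0_fun_scaleR norm_lip0_def)
  then show ?thesis using assms by (rule bounded_linear.tendsto)
qed

lemma borel_measurable_lip0_fun: "lip0_fun \<phi> \<in> borel_measurable borel"
  by (intro borel_measurable_continuous_onI lipschitz_on_continuous_on[OF lip0_fun_lipschitz])

text \<open>On each of the finitely many level sets of \<open>s\<close> a single continuous function
  is composed with \<open>f\<close>.\<close>

lemma composition_op_simple_measurable: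
  assumes s: "simple_function M s" and f: "f \<in> borel_measurable M"
  shows "composition_op s f \<in> borel_measurable M"
proof -
  have "(\<lambda>w. lip0_fun (s w) (f w)) \<in> borel_measurable M"
  proof (rule measurable_compose_countable'[where I = "s ` space M"])
    show "(\<lambda>w. lip0_fun \<phi> (f w)) \<in> borel_measurable M" for \<phi>
      by (rule measurable_compose[OF f borel_measurable_lip0_fun])
    show "s \<in> measurable M (count_space (s ` space M))"
      using s by (auto simp: measurable_count_space_eq2 simple_function_def)
    show "countable (s ` space M)"
      using s by (simp add: simple_function_def countable_finite)
  qed
  then show ?thesis unfolding composition_op_def[abs_def] .
qed

lemma composition_op_measurable:
  assumes M: "complete_measure M" and \<Phi>: "strongly_measurable M \<Phi>" and f: "f \<in> borel_measurable M"
  shows "composition_op \<Phi> f \<in> borel_measurable M"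
proof -
  obtain s where s: "\<And>n::nat. simple_function M (s n)" and lim: "AE w in M. (\<lambda>n. s n w) \<longlonglongrightarrow> \<Phi> w"
    using \<Phi> unfolding strongly_measurable_def by auto
  \<comment> \<open>Where the sequence diverges, \<open>lim\<close> takes an unspecified value; the
    function is still measurable, and that set is null.\<close>
  have "(\<lambda>w. lim (\<lambda>n. composition_op (s n) f w)) \<in> borel_measurable M"
    by (intro borel_measurable_lim_metric composition_op_simple_measurable s f)
  moreover have "AE w in M. lim (\<lambda>n. composition_op (s n) f w) = composition_op \<Phi> f w"
    using lim by eventually_elim (auto simp: composition_op_def intro: limI lip0_tendsto_apply)
  ultimately show ?thesis
    by (rule complete_measure.measurable_cong_AE_complete[OF M]) auto
qed

section \<open>Order and summability in a Banach function space\<close>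

context banach_function_space
begin

lemma abs_mem: "f \<in> X \<Longrightarrow> (\<lambda>w. \<bar>f w\<bar>) \<in> X"
  by (rule ideal[OF borel_measurable_abs]) (use measurable in auto)

lemma diff_mem: "f \<in> X \<Longrightarrow> g \<in> X \<Longrightarrow> (\<lambda>w. f w - g w) \<in> X"
  using add[of f "\<lambda>w. - 1 * g w"] scale[of g "- 1"] by simp

lemma const_mem: "(\<lambda>w. c) \<in> X"
  by (rule ideal[OF _ scale[OF indicator_space, of c]]) auto

lemma sum_mem: "(\<And>i. i \<in> I \<Longrightarrow> f i \<in> X) \<Longrightarrow> (\<lambda>w. \<Sum>i\<in>I. f i w) \<in> X"
  by (induction I rule: infinite_finite_induct) (simp_all add: zero add)

lemma norm_zero: "nX (\<lambda>w. 0) = 0"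
  using norm_eq_0[OF zero] by simp

lemma norm_abs: "f \<in> X \<Longrightarrow> nX (\<lambda>w. \<bar>f w\<bar>) = nX f"
  by (intro antisym norm_mono abs_mem) auto

lemma norm_minus_commute: "f \<in> X \<Longrightarrow> g \<in> X \<Longrightarrow> nX (\<lambda>w. f w - g w) = nX (\<lambda>w. g w - f w)"
  by (intro antisym norm_mono diff_mem) auto

lemma norm_sum_le: "(\<And>i. i \<in> I \<Longrightarrow> f i \<in> X) \<Longrightarrow> nX (\<lambda>w. \<Sum>i\<in>I. f i w) \<le> (\<Sum>i\<in>I. nX (f i))"
proof (induction I rule: infinite_finite_induct)
  case (insert i I)
  then show ?case
    using norm_triangle[of "f i" "\<lambda>w. \<Sum>i\<in>I. f i w"] by (simp add: sum_mem)
qed (simp_all add: norm_zero)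

text \<open>The norm convergence only enters through \<open>\<parallel>(s\<^sub>n - F)\<^sup>+\<parallel> \<le> \<parallel>s\<^sub>m - F\<parallel>\<close> for \<open>m \<ge> n\<close>.\<close>

lemma incseq_le_norm_limit:
  assumes s: "\<And>n. s n \<in> X" and F: "F \<in> X" and mono: "\<And>m n w. n \<le> m \<Longrightarrow> s n w \<le> s m w"
    and lim: "(\<lambda>n. nX (\<lambda>w. s n w - F w)) \<longlonglongrightarrow> 0"
  shows "AE w in M. s n w \<le> F w"
proof -
  let ?d = "\<lambda>w. max 0 (s n w - F w)"
  have d: "?d \<in> X"
    using measurable s F
    by (intro ideal[OF _ diff_mem[OF s[of n] F]] borel_measurable_max borel_measurable_diff) auto
  have "nX ?d \<le> nX (\<lambda>w. s m w - F w)" if "n \<le> m" for m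
    using mono[OF that] by (intro norm_mono d diff_mem s F AE_I2) (smt (verit))
  then have "nX ?d \<le> 0" using lim by (intro LIMSEQ_le_const[of _ 0]) auto
  then have "nX ?d = 0" using norm_nonneg[OF d] by simp
  then have "AE w in M. ?d w = 0" using norm_eq_0[OF d] by simp
  then show ?thesis by eventually_elim simp
qed

text \<open>\<open>F\<close> is the norm limit of the partial sums, which are Cauchy by the triangle
  inequality. Nonnegative terms make these sums increase, so \<open>F\<close> dominates each of
  them, hence each term.\<close>

lemma summable_dominating:
  fixes f :: "nat \<Rightarrow> 'a \<Rightarrow> real"
  assumes f: "\<And>n. f n \<in> X" and nonneg: "\<And>n w. 0 \<le> f n w" and sum: "summable (\<lambda>n. nX (f n))"
  obtains F where "F \<in> X" and "\<And>n. AE w in M. f n w \<le> F w"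
proof -
  define s where "s n w = (\<Sum>i<n. f i w)" for n w
  have s: "s n \<in> X" for n unfolding s_def[abs_def] by (intro sum_mem f)
  have diff: "nX (\<lambda>w. s m w - s n w) \<le> norm (\<Sum>i\<in>{n..<m}. nX (f i))" if "n \<le> m" for m n
  proof -
    have "(\<lambda>w. s m w - s n w) = (\<lambda>w. \<Sum>i\<in>{n..<m}. f i w)"
      using that sum_diff_nat_ivl[of 0 n m] by (auto simp: s_def atLeast0LessThan)
    then show ?thesis
      using norm_sum_le[of "{n..<m}" f] f by (simp add: order.trans[OF _ abs_ge_self])
  qed
  have "\<exists>N. \<forall>m\<ge>N. \<forall>n\<ge>N. nX (\<lambda>w. s m w - s n w) < e" if "0 < e" for e
  proof -
    obtain N where N: "\<And>m n. N \<le> m \<Longrightarrow> norm (\<Sum>i\<in>{m..<n}. nX (f i)) < e"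
      using sum \<open>0 < e\<close> unfolding summable_Cauchy by blast
    have le: "nX (\<lambda>w. s m w - s n w) < e" if "N \<le> n" "n \<le> m" for m n
      using diff[OF that(2)] N[OF that(1), of m] by simp
    have "nX (\<lambda>w. s m w - s n w) < e" if "N \<le> m" "N \<le> n" for m n
      using le[of n m] le[of m n] that norm_minus_commute[OF s s, of m n] by (cases "n \<le> m") auto
    then show ?thesis by blast
  qed
  then obtain F where F: "F \<in> X" "(\<lambda>n. nX (\<lambda>w. s n w - F w)) \<longlonglongrightarrow> 0"
    using complete[of s] s by blast
  have le_F: "AE w in M. s n w \<le> F w" for n
    by (rule incseq_le_norm_limit[OF s F(1) _ F(2)])
       (auto simp: s_def intro!: sum_mono2 nonneg)
  \<comment> \<open>The index shifts because \<open>s n\<close> sums over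
    \<open>i < n\<close>.\<close>
  have f_le: "f n w \<le> s (Suc n) w" for n w
    by (simp add: s_def sum_nonneg nonneg)
  have "AE w in M. f n w \<le> F w" for n
    using le_F[of "Suc n"] by eventually_elim (rule order.trans[OF f_le])
  with F(1) show thesis by (rule that)
qed

end

section \<open>Automatic boundedness of multiplication operators\<close>

lemma multiplier_bounded:
  assumes X: "banach_function_space M X nX" and Y: "banach_function_space M Y nY"
    and h: "h \<in> multipliers M X Y"
  obtains C where "0 \<le> C" and "\<And>f. f \<in> X \<Longrightarrow> nY (\<lambda>w. h w * f w) \<le> C * nX f"
proof -
  interpret X: banach_function_space M X nX by (rule X)
  interpret Y: banach_function_space M Y nY by (rule Y)
  have hf: "(\<lambda>w. h w * f w) \<in> Y" if "f \<in> X" for f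
    using h that by (simp add: multipliers_def)
  have "\<exists>C\<ge>0. \<forall>f\<in>X. nY (\<lambda>w. h w * f w) \<le> C * nX f"
  proof (rule ccontr)
    assume "\<not> ?thesis"
    then have "\<exists>f\<in>X. real n * 2 ^ n * nX f < nY (\<lambda>w. h w * f w)" for n
      by (metis not_le mult_nonneg_nonneg of_nat_0_le_iff zero_le_numeral zero_le_power)
    then obtain f where f: "\<And>n. f n \<in> X" and
      big: "\<And>n. real n * 2 ^ n * nX (f n) < nY (\<lambda>w. h w * f n w)" by metis
    \<comment> \<open>Needed to normalise \<open>f n\<close>. If \<open>f n\<close> were null, both
      sides of the strict inequality \<open>big\<close> would be 0.\<close>
    have pos: "0 < nX (f n)" for n
    proof (rule ccontr)
      assume "\<not> ?thesis"
      then have "AE w in M. f n w = 0"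
        using X.norm_nonneg[OF f[of n]] X.norm_eq_0[OF f[of n]] by simp
      then have "AE w in M. h w * f n w = 0" by eventually_elim simp
      then have "nY (\<lambda>w. h w * f n w) = 0" using Y.norm_eq_0[OF hf[OF f]] by simp
      then show False
        using big[of n] X.norm_nonneg[OF f[of n]] by (simp add: mult_less_0_iff)
    qed
    \<comment> \<open>This weight normalises \<open>f n\<close> and adds the factor
      \<open>1 / 2^n\<close>: it gives \<open>g n\<close> the summable norm \<open>(1/2)^n\<close>
      and turns the lower bound in \<open>big\<close> into exactly \<open>n\<close>.\<close>
    define c where "c n = 1 / (2 ^ n * nX (f n))" for n
    have c: "0 < c n" for n using pos by (simp add: c_def)
    define g where "g n w = c n * \<bar>f n w\<bar>" for n w
    have g: "g n \<in> X" for n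
      unfolding g_def[abs_def] by (intro X.scale X.abs_mem f)
    have "nX (g n) = (1 / 2) ^ n" for n
    proof -
      have "nX (g n) = c n * nX (f n)"
        using X.norm_scale[OF X.abs_mem[OF f], of "c n"] c[of n]
        by (simp add: g_def[abs_def] X.norm_abs[OF f])
      then show ?thesis using pos[of n] by (simp add: c_def power_divide)
    qed
    then have "summable (\<lambda>n. nX (g n))" by simp
    moreover have "0 \<le> g n w" for n w using c[of n] by (simp add: g_def)
    ultimately obtain F where F: "F \<in> X" and le: "\<And>n. AE w in M. g n w \<le> F w"
      using X.summable_dominating[of g] g by blast
    have "real n < nY (\<lambda>w. h w * F w)" for n
    proof -
      have "real n = c n * (real n * 2 ^ n * nX (f n))"
        using pos[of n] by (simp add: c_def)
      also have "\<dots> < c n * nY (\<lambda>w. h w * f n w)"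
        using big c by (intro mult_strict_left_mono)
      also have "\<dots> = nY (\<lambda>w. c n * (h w * f n w))"
        using c[of n] by (simp add: Y.norm_scale[OF hf[OF f]])
      also have "\<dots> \<le> nY (\<lambda>w. h w * F w)"
      proof (rule Y.norm_mono[OF Y.scale[OF hf[OF f]] hf[OF F]])
        show "AE w in M. \<bar>c n * (h w * f n w)\<bar> \<le> \<bar>h w * F w\<bar>"
          using le[of n]
        proof eventually_elim
          case (elim w)
          have "\<bar>c n * (h w * f n w)\<bar> = \<bar>h w\<bar> * g n w"
            using c[of n] by (simp add: g_def abs_mult)
          also have "\<dots> \<le> \<bar>h w\<bar> * \<bar>F w\<bar>"
            using elim by (intro mult_left_mono) auto
          finally show ?case by (simp add: abs_mult)
        qed
      qed
      finally show ?thesis .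
    qed
    moreover obtain n where "nY (\<lambda>w. h w * F w) < real n" using reals_Archimedean2 by blast
    ultimately show False by (meson less_asym)
  qed
  then show thesis using that by blast
qed

section \<open>Optimality of the bound function\<close>

text \<open>By continuity, the Lipschitz estimate passes from the rationals to their
  closure.\<close>

lemma Lip_le_rational:
  assumes cont: "continuous_on UNIV \<phi>"
    and le: "\<And>p q. p \<in> \<rat> \<Longrightarrow> q \<in> \<rat> \<Longrightarrow> \<bar>\<phi> p - \<phi> q\<bar> \<le> L * \<bar>p - q\<bar>"
  shows "Lip \<phi> \<le> L"
proof -
  \<comment> \<open>In the application \<open>L\<close> is a value \<open>h w\<close> of unknown
    sign; the pair 1, 0 forces it to be nonnegative.\<close>
  have "0 \<le> L" using le[of 1 0] by simp
  then have "L-lipschitz_on \<rat> \<phi>"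
    using le by (intro lipschitz_onI) (simp_all add: dist_real_def)
  then have "L-lipschitz_on UNIV \<phi>"
    using lipschitz_on_closure[of L \<rat> \<phi>] cont by (simp add: Rats_closure_real)
  then show ?thesis by (rule Lip_le)
qed

text \<open>On the constant \<open>p\<close> the operator returns
  \<open>lip0_fun (\<Phi> w) p\<close>, so constants recover the function at \<open>w\<close>. They
  lie in \<open>X\<close> because the indicator of the space does.\<close>

lemma Lip_le_lattice_lipschitz_bound:
  assumes X: "banach_function_space M X nX"
    and h: "lattice_lipschitz_ineq M X (composition_op \<Phi>) h"
  shows "AE w in M. Lip (lip0_fun (\<Phi> w)) \<le> h w"
proof -
  have "AE w in M. \<bar>lip0_fun (\<Phi> w) p - lip0_fun (\<Phi> w) q\<bar> \<le> h w * \<bar>p - q\<bar>" for p q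
    using h banach_function_space.const_mem[OF X, of p] banach_function_space.const_mem[OF X, of q]
    unfolding lattice_lipschitz_ineq_def composition_op_def by fastforce
  then have "AE w in M. \<forall>p\<in>\<rat>. \<forall>q\<in>\<rat>. \<bar>lip0_fun (\<Phi> w) p - lip0_fun (\<Phi> w) q\<bar> \<le> h w * \<bar>p - q\<bar>"
    by (simp add: AE_ball_countable countable_rat)
  then show ?thesis
    by eventually_elim
      (auto intro!: Lip_le_rational lipschitz_on_continuous_on[OF lip0_fun_lipschitz])
qed

theorem proposition4p1:
  fixes M :: "'a measure"
    and X Y :: "('a \<Rightarrow> real) set"
    and nX nY :: "('a \<Rightarrow> real) \<Rightarrow> real"
    and \<Phi> :: "'a \<Rightarrow> lip0"
  assumes "complete_measure M" and "finite_measure M"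
    and "banach_function_space M X nX"
    and "banach_function_space M Y nY"
    and "\<Phi> \<in> lip0_multipliers M X Y"
  shows
    "((\<forall>f\<in>X. composition_op \<Phi> f \<in> Y) \<and>
      (\<forall>f\<in>X. \<forall>g\<in>X. (AE w in M. f w = g w) \<longrightarrow>
         (AE w in M. composition_op \<Phi> f w = composition_op \<Phi> g w))) \<and>
     (\<exists>C\<ge>0. \<forall>f\<in>X. \<forall>g\<in>X.
        nY (\<lambda>w. composition_op \<Phi> f w - composition_op \<Phi> g w) \<le> C * nX (\<lambda>w. f w - g w)) \<and>
     (lattice_lipschitz M X (composition_op \<Phi>) (\<lambda>w. Lip (lip0_fun (\<Phi> w))) \<and>
      (\<forall>h\<in>borel_measurable M. lattice_lipschitz_ineq M X (composition_op \<Phi>) h \<longrightarrow>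
         (AE w in M. Lip (lip0_fun (\<Phi> w)) \<le> h w))) \<and>
     (\<forall>\<Psi> :: 'a \<Rightarrow> lip0. (AE w in M. \<Phi> w = \<Psi> w) \<longrightarrow>
        (\<forall>f\<in>X. composition_op \<Psi> f \<in> borel_measurable M \<and>
           (AE w in M. composition_op \<Phi> f w = composition_op \<Psi> f w)) \<and>
        (AE w in M. Lip (lip0_fun (\<Phi> w)) = Lip (lip0_fun (\<Psi> w))))"
proof -
  interpret X: banach_function_space M X nX by (rule assms(3))
  interpret Y: banach_function_space M Y nY by (rule assms(4))
  define K where "K w = Lip (lip0_fun (\<Phi> w))" for w
  have sm: "strongly_measurable M \<Phi>" and K: "K \<in> multipliers M X Y"
    using assms(5) by (simp_all add: lip0_multipliers_def K_def[abs_def])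
  have K0: "0 \<le> K w" for w
    unfolding K_def by (rule Lip_nonneg[OF lip0_fun_lipschitz])
  have diff_le: "\<bar>composition_op \<Phi> f w - composition_op \<Phi> g w\<bar> \<le> K w * \<bar>f w - g w\<bar>" for f g w
    unfolding composition_op_def K_def by (rule lip0_fun_le)
  have meas: "composition_op \<Phi> f \<in> borel_measurable M" if "f \<in> X" for f
    using composition_op_measurable[OF assms(1) sm] X.measurable that by blast
  have KX: "(\<lambda>w. K w * f w) \<in> Y" if "f \<in> X" for f
    using K that by (simp add: multipliers_def)
  \<comment> \<open>Comparison with the zero function, whose image is 0, bounds the image of
    \<open>f\<close> by \<open>K * f\<close> in absolute value; the ideal property of
    \<open>Y\<close> applies.\<close>
  have inY: "composition_op \<Phi> f \<in> Y" if f: "f \<in> X" for f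
  proof (rule Y.ideal[OF meas[OF f] KX[OF f]])
    show "AE w in M. \<bar>composition_op \<Phi> f w\<bar> \<le> \<bar>K w * f w\<bar>"
      using diff_le[of f _ "\<lambda>w. 0"] K0 by (simp add: composition_op_def abs_mult)
  qed
  obtain C where C: "0 \<le> C" "\<And>f. f \<in> X \<Longrightarrow> nY (\<lambda>w. K w * f w) \<le> C * nX f"
    using multiplier_bounded[OF assms(3,4) K] by blast
  have lip: "nY (\<lambda>w. composition_op \<Phi> f w - composition_op \<Phi> g w) \<le> C * nX (\<lambda>w. f w - g w)"
    if f: "f \<in> X" and g: "g \<in> X" for f g
  proof -
    have "nY (\<lambda>w. composition_op \<Phi> f w - composition_op \<Phi> g w) \<le> nY (\<lambda>w. K w * (f w - g w))"
      using diff_le[of f _ g] K0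
      by (intro Y.norm_mono Y.diff_mem inY f g KX X.diff_mem) (simp add: abs_mult)
    also have "\<dots> \<le> C * nX (\<lambda>w. f w - g w)" by (rule C(2)[OF X.diff_mem[OF f g]])
    finally show ?thesis .
  qed
  have ll: "lattice_lipschitz M X (composition_op \<Phi>) K"
    using meas K0 diff_le by (auto simp: lattice_lipschitz_def lattice_lipschitz_ineq_def)
  have best: "AE w in M. Lip (lip0_fun (\<Phi> w)) \<le> h w"
    if "lattice_lipschitz_ineq M X (composition_op \<Phi>) h" for h
    by (rule Lip_le_lattice_lipschitz_bound[OF assms(3) that])
  have cong: "AE w in M. composition_op \<Phi> f w = composition_op \<Phi> g w"
    if "AE w in M. f w = g w" for f g
    using that by eventually_elim (simp add: composition_op_def)
  have \<Psi>: "AE w in M. composition_op \<Phi> f w = composition_op \<Psi> f w"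
      "AE w in M. Lip (lip0_fun (\<Phi> w)) = Lip (lip0_fun (\<Psi> w))"
    if "AE w in M. \<Phi> w = \<Psi> w" for \<Psi> f
    using that by (eventually_elim, simp add: composition_op_def)+
  \<comment> \<open>Here \<open>\<Psi>\<close> is an arbitrary function; measurability is inherited
    from \<open>\<Phi>\<close> through completeness.\<close>
  have \<Psi>_meas: "composition_op \<Psi> f \<in> borel_measurable M"
    if "AE w in M. \<Phi> w = \<Psi> w" "f \<in> X" for \<Psi> f
    by (rule complete_measure.measurable_cong_AE_complete[OF assms(1) meas[OF that(2)] \<Psi>(1)[OF that(1)]])
      simp
  show ?thesis
    using inY cong lip C(1) ll[unfolded K_def[abs_def]] best \<Psi> \<Psi>_meas by blast
qed

end
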